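(* Every Banach space whose norm is uniformly micro-semitransitive (in particular, every Banach space whose norm is micro-transitive) is both uniformly smooth and uniformly convex.
   Context: Banach spaces are over $\mathbb{K}=\mathbb{R}$ or $\mathbb{C}$. $S_X$ and $B_X$ are the unit sphere and closed unit ball of $X$, $\mathcal{L}(X)$ the space of bounded linear operators on $X$ with the operator norm, and $\mathrm{Id}$ the identity operator. The norm of $X$ is micro-transitive if the group $G$ of surjective linear isometries of $X$ (with the operator-norm topology) acts micro-transitively on $S_X$: for every $x\in S_X$ and every neighborhood $U$ of $\mathrm{Id}$ in $G$, the set $Ux=\{Tx : T\in U\}$ is a neighborhood of $x$ in $S_X$. The norm of $X$ is uniformly micro-semitransitive if there is a function $\beta:(0,2)\to(0,\infty)$ such that whenever $\varepsilon\in(0,2)$ and $x,y\in S_X$ satisfy $\|x-y\|<\beta(\varepsilon)$, there is $T\in\mathcal{L}(X)$ with $\|T\|=1$, $Tx=y$ and $\|T-\mathrm{Id}\|<\varepsilon$. $X$ is uniformly smooth if its norm is Fréchet differentiable uniformly on $S_X$. $X$ is uniformly convex if $\delta_X(\varepsilon)>0$ for all $\varepsilon\in(0,2]$, where $\delta_X(\varepsilon)=\inf\{1-\|\tfrac{x+y}{2}\| : x,y\in B_X,\ \|x-y\|\ge\varepsilon\}$. *)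

theory Defs
  imports "HOL-Analysis.Analysis"
begin

text \<open>
  A Banach space over \<open>\<real>\<close> or \<open>\<complex>\<close> is a type of class \<open>banach\<close> together with
  a scalar multiplication \<open>smul\<close> by elements of \<open>real\<close> or \<open>complex\<close>. Over \<open>real\<close> the only
  possible \<open>smul\<close> is \<^term>\<open>(*\<^sub>R)\<close>; over \<open>complex\<close> it extends \<^term>\<open>(*\<^sub>R)\<close>,
  and a space may carry many of them.
\<close>

locale banach_space_over = vector_space smul
  for smul :: "'k::real_normed_field \<Rightarrow> 'a::banach \<Rightarrow> 'a" +
  assumes smul_of_real: "smul (of_real r) x = r *\<^sub>R x"
    and norm_smul: "norm (smul c x) = norm c * norm x"

lemma banach_space_over_scaleR:
  "banach_space_over ((*\<^sub>R) :: real \<Rightarrow> 'a::banach \<Rightarrow> 'a)"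
  by unfold_locales (simp_all add: algebra_simps)

text \<open>
  The real operator norm of a map that is linear over the larger field is also its operator
  norm over that field, so the operators are a subset of the real ones, with the same norm and
  topology.
\<close>

definition bounded_operators ::
    "('k::real_normed_field \<Rightarrow> 'a::banach \<Rightarrow> 'a) \<Rightarrow> ('a \<Rightarrow>\<^sub>L 'a) set" where
  "bounded_operators smul =
     {T. \<forall>c x. blinfun_apply T (smul c x) = smul c (blinfun_apply T x)}"

definition isometry_group ::
    "('k::real_normed_field \<Rightarrow> 'a::banach \<Rightarrow> 'a) \<Rightarrow> ('a \<Rightarrow>\<^sub>L 'a) set" where
  "isometry_group smul =
     {T \<in> bounded_operators smul.
        surj (blinfun_apply T) \<and> (\<forall>x. norm (blinfun_apply T x) = norm x)}"

definition neighbourhood_in :: "'a topology \<Rightarrow> 'a \<Rightarrow> 'a set \<Rightarrow> bool" where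
  "neighbourhood_in X x N \<longleftrightarrow>
     N \<subseteq> topspace X \<and> (\<exists>V. openin X V \<and> x \<in> V \<and> V \<subseteq> N)"

definition micro_transitive ::
    "('k::real_normed_field \<Rightarrow> 'a::banach \<Rightarrow> 'a) \<Rightarrow> bool" where
  "micro_transitive smul \<longleftrightarrow>
     (\<forall>x \<in> sphere 0 1. \<forall>U.
        neighbourhood_in (top_of_set (isometry_group smul)) id_blinfun U \<longrightarrow>
        neighbourhood_in (top_of_set (sphere 0 1)) x ((\<lambda>T. blinfun_apply T x) ` U))"

text \<open>Only the values of \<open>\<beta>\<close> on the interval \<open>(0, 2)\<close> are constrained.\<close>

definition uniformly_micro_semitransitive ::
    "('k::real_normed_field \<Rightarrow> 'a::banach \<Rightarrow> 'a) \<Rightarrow> bool" where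
  "uniformly_micro_semitransitive smul \<longleftrightarrow>
     (\<exists>\<beta> :: real \<Rightarrow> real.
        (\<forall>\<epsilon> \<in> {0<..<2}. \<beta> \<epsilon> > 0) \<and>
        (\<forall>\<epsilon> \<in> {0<..<2}. \<forall>x \<in> sphere 0 1. \<forall>y \<in> sphere 0 1.
           norm (x - y) < \<beta> \<epsilon> \<longrightarrow>
           (\<exists>T \<in> bounded_operators smul.
              norm T = 1 \<and> blinfun_apply T x = y \<and> norm (T - id_blinfun) < \<epsilon>)))"

text \<open>
  The derivative of the norm is taken over \<open>\<real>\<close>, also when the scalars are complex: the norm
  is real-valued. The second conjunct makes the differentiability uniform on the unit sphere.
\<close>

definition uniformly_smooth :: "'a::real_normed_vector itself \<Rightarrow> bool" where
  "uniformly_smooth _ \<longleftrightarrow>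
     (\<exists>D :: 'a \<Rightarrow> 'a \<Rightarrow> real.
        (\<forall>x \<in> sphere 0 1. (norm has_derivative D x) (at x)) \<and>
        (\<forall>\<epsilon> > 0. \<exists>\<delta> > 0. \<forall>x \<in> sphere 0 1. \<forall>h. norm h < \<delta> \<longrightarrow>
           \<bar>norm (x + h) - norm x - D x h\<bar> \<le> \<epsilon> * norm h))"

text \<open>
  The infimum is taken in \<open>ereal\<close>, so that it is \<open>\<infinity>\<close> if there are no admissible pairs;
  for \<open>\<epsilon> \<in> (0, 2]\<close> this happens only in the zero space.
\<close>

definition modulus_of_convexity :: "'a::real_normed_vector itself \<Rightarrow> real \<Rightarrow> ereal" where
  "modulus_of_convexity _ \<epsilon> =
     Inf {ereal (1 - norm ((x + y) /\<^sub>R 2)) | x y :: 'a.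
            x \<in> cball 0 1 \<and> y \<in> cball 0 1 \<and> norm (x - y) \<ge> \<epsilon>}"

definition uniformly_convex :: "'a::real_normed_vector itself \<Rightarrow> bool" where
  "uniformly_convex X \<longleftrightarrow> (\<forall>\<epsilon> \<in> {0<..2}. modulus_of_convexity X \<epsilon> > 0)"

end

theory Submission
  imports Defs
begin

text \<open>
  A contraction near the identity that takes \<open>x\<close> to a nearby \<open>y\<close> gives
  \<open>\<parallel>y + h\<parallel> \<le> \<parallel>x + h\<parallel> + \<epsilon> \<parallel>h\<parallel>\<close> for all \<open>h\<close>; with \<open>x + h\<close>, normalised, in the role of the
  first point this bounds \<open>\<parallel>x + h\<parallel> + \<parallel>x - h\<parallel> - 2\<close> by \<open>\<epsilon> \<parallel>h\<parallel>\<close>, which is uniform smoothness.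

  A uniformly smooth ball has slices of arbitrarily small radius. Otherwise let \<open>R > 0\<close> be the
  infimum of the radii, and take a slice of almost that radius with centre \<open>c\<close>. Passing to
  subslices twice yields \<open>a = z\<^sub>1 - c\<close> and \<open>b = z\<^sub>2 - c\<close> of norm about \<open>R\<close> such that one functional of
  norm 1 almost norms both, while \<open>\<parallel>b - s a\<parallel> \<ge> R - o(1)\<close> for a small fixed \<open>s\<close>. Then
  \<open>\<parallel>b + s a\<parallel> + \<parallel>b - s a\<parallel>\<close> is about \<open>2 R + s R\<close>, against smoothness at \<open>b\<close>.

  A small slice contains a unit vector \<open>x\<close> with \<open>max \<parallel>x \<plusminus> h\<parallel> \<ge> 1 + \<eta>\<close> for \<open>\<parallel>h\<parallel> \<ge> r\<close>. A contraction
  within \<open>1/2\<close> of the identity transports this property along the sphere at the cost of a factor 2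
  in \<open>r\<close>, and any two points are joined, up to sign, by a chain whose length is bounded uniformly.
  So the property holds at all points with the same constants, which is uniform convexity.
\<close>

text \<open>\<open>T\<close> is merely real-linear, so that one notion serves both scalar fields.\<close>

definition near_identity_transitive :: "'a::real_normed_vector itself \<Rightarrow> bool" where
  "near_identity_transitive _ \<longleftrightarrow>
     (\<forall>\<epsilon>>0. \<exists>\<beta>>0. \<forall>x \<in> sphere (0::'a) 1. \<forall>y \<in> sphere 0 1. norm (x - y) < \<beta> \<longrightarrow>
        (\<exists>T :: 'a \<Rightarrow>\<^sub>L 'a. norm T \<le> 1 \<and> blinfun_apply T x = y \<and> norm (T - id_blinfun) < \<epsilon>))"

lemma near_identity_transitiveD:
  assumes "near_identity_transitive TYPE('a::real_normed_vector)" and "\<epsilon> > 0"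
  obtains \<beta> where "\<beta> > 0"
    "\<And>x y. norm x = 1 \<Longrightarrow> norm (y::'a) = 1 \<Longrightarrow> norm (x - y) < \<beta> \<Longrightarrow>
       \<exists>T :: 'a \<Rightarrow>\<^sub>L 'a. norm T \<le> 1 \<and> blinfun_apply T x = y \<and> norm (T - id_blinfun) < \<epsilon>"
  using assms unfolding near_identity_transitive_def by (metis mem_sphere_0)

text \<open>Multiplied by \<open>norm u\<close>, the difference of the directions is
  \<open>u - v\<close> plus a radial correction of length at most
  \<open>\<bar>norm v - norm u\<bar>\<close>, and both are bounded by \<open>norm (u - v)\<close>.
  So normalising is Lipschitz where \<open>norm u\<close> is bounded below.\<close>

lemma norm_sgn_diff_le:
  fixes u v :: "'a::real_normed_vector"
  assumes "u \<noteq> 0"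
  shows "norm (sgn u - sgn v) \<le> 2 * norm (u - v) / norm u"
proof (cases "v = 0")
  case True
  then show ?thesis using assms by (simp add: norm_sgn)
next
  case False
  have "norm u *\<^sub>R (sgn u - sgn v) = (u - v) + (norm v - norm u) *\<^sub>R sgn v"
    using assms False by (simp add: sgn_div_norm algebra_simps)
  then have "norm u * norm (sgn u - sgn v) = norm ((u - v) + (norm v - norm u) *\<^sub>R sgn v)"
    by (metis abs_norm_cancel norm_scaleR)
  also have "\<dots> \<le> norm (u - v) + \<bar>norm v - norm u\<bar>"
    using norm_triangle_ineq[of "u - v" "(norm v - norm u) *\<^sub>R sgn v"] False
    by (simp add: norm_sgn)
  also have "\<dots> \<le> 2 * norm (u - v)"
    using norm_triangle_ineq3[of v u] by (simp add: norm_minus_commute)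
  finally show ?thesis using assms by (simp add: field_simps)
qed

subsection \<open>Uniform smoothness\<close>

text \<open>If \<open>T\<close> takes \<open>u = sgn (x + h)\<close> to \<open>x\<close>, then
  \<open>x - h\<close> is \<open>T (u - h)\<close> plus \<open>(T - Id) h\<close>. To first order in
  \<open>h\<close>, the point \<open>u - h\<close> is \<open>x / n\<close> with
  \<open>n = norm (x + h)\<close>. Hence the sum of the two norms is about \<open>n + 1 / n\<close>,
  which exceeds 2 only to second order, up to the small term from \<open>T - Id\<close>.\<close>

lemma near_identity_transitive_imp_second_difference:
  assumes "near_identity_transitive TYPE('a::real_normed_vector)" and "\<epsilon> > 0"
  shows "\<exists>\<delta>>0. \<forall>x \<in> sphere (0::'a) 1. \<forall>h. norm h < \<delta> \<longrightarrow>
    norm (x + h) + norm (x - h) \<le> 2 + \<epsilon> * norm h"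
proof -
  obtain \<beta> where \<beta>: "\<beta> > 0" "\<And>x y. norm x = 1 \<Longrightarrow> norm (y::'a) = 1 \<Longrightarrow> norm (x - y) < \<beta> \<Longrightarrow>
       \<exists>T :: 'a \<Rightarrow>\<^sub>L 'a. norm T \<le> 1 \<and> blinfun_apply T x = y \<and> norm (T - id_blinfun) < \<epsilon> / 2"
    using near_identity_transitiveD[OF assms(1), of "\<epsilon>/2"] assms(2) by auto
  \<comment> \<open>The three bounds keep \<open>n\<close> above 1/2, bring \<open>u\<close> within
    \<open>\<beta>\<close> of \<open>x\<close>, and make the quadratic remainder
    \<open>4 * (norm h * norm h)\<close> at most \<open>\<epsilon> / 2 * norm h\<close>.\<close>
  define \<delta> where "\<delta> = min (1/2) (min (\<beta> / 2) (\<epsilon> / 8))"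
  have "\<delta> > 0" using \<beta>(1) assms(2) by (simp add: \<delta>_def)
  moreover have "norm (x + h) + norm (x - h) \<le> 2 + \<epsilon> * norm h"
    if x: "norm x = 1" and h: "norm h < \<delta>" for x h :: 'a
  proof -
    define n where "n = norm (x + h)"
    have n1: "\<bar>n - 1\<bar> \<le> norm h"
      using norm_triangle_ineq3[of "x + h" x] x by (simp add: n_def)
    have hb: "norm h < 1/2" "norm h < \<beta>/2" "norm h < \<epsilon>/8" using h by (auto simp: \<delta>_def)
    have n: "n \<ge> 1/2" using n1 hb by linarith
    define u where "u = (x + h) /\<^sub>R n"
    have u1: "norm u = 1" using n by (simp add: u_def flip: n_def)
    have sx: "sgn x = x" "sgn (x + h) = u"
      using x by (simp_all add: u_def n_def sgn_div_norm)
    have "norm (x - u) \<le> 2 * norm h"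
      using norm_sgn_diff_le[of x "x + h"] x unfolding sx by fastforce
    then have "norm (u - x) < \<beta>" using hb by (simp add: norm_minus_commute)
    then obtain T :: "'a \<Rightarrow>\<^sub>L 'a" where T: "norm T \<le> 1" "blinfun_apply T u = x" "norm (T - id_blinfun) < \<epsilon> / 2"
      using \<beta>(2)[of u x] x u1 by auto
    have "x - h = blinfun_apply T (u - h) + blinfun_apply (T - id_blinfun) h"
      by (simp add: blinfun.diff_left blinfun.diff_right T)
    then have "norm (x - h) \<le> norm (blinfun_apply T (u - h)) + norm (blinfun_apply (T - id_blinfun) h)"
      by (metis norm_triangle_ineq)
    also have "norm (blinfun_apply T (u - h)) \<le> norm (u - h)"
      using norm_blinfun[of T "u - h"] T(1) mult_right_mono[of "norm T" 1 "norm (u - h)"] by simp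
    also have "norm (blinfun_apply (T - id_blinfun) h) \<le> \<epsilon> / 2 * norm h"
      using norm_blinfun[of "T - id_blinfun" h] T(3)
        mult_right_mono[of "norm (T - id_blinfun)" "\<epsilon>/2" "norm h"] by simp
    also have "u - h = (x - (n - 1) *\<^sub>R h) /\<^sub>R n"
      using n by (simp add: u_def algebra_simps)
    also have "norm \<dots> \<le> (1 + norm h * norm h) / n"
    proof -
      have "norm (x - (n - 1) *\<^sub>R h) \<le> 1 + \<bar>n - 1\<bar> * norm h"
        using norm_triangle_ineq4[of x "(n - 1) *\<^sub>R h"] x by simp
      also have "\<dots> \<le> 1 + norm h * norm h" using n1 by (simp add: mult_right_mono)
      finally show ?thesis using n by (simp add: divide_right_mono divide_inverse_commute[symmetric])
    qed
    finally have "n + norm (x - h) \<le> n + (1 + norm h * norm h) / n + \<epsilon> / 2 * norm h" by simp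
    \<comment> \<open>Since \<open>n * n + 1 = 2 * n + (n - 1) * (n - 1)\<close> and
      \<open>\<bar>n - 1\<bar> \<le> norm h\<close>, only a quadratic excess survives; dividing it
      by \<open>n \<ge> 1/2\<close> at most doubles it.\<close>
    moreover have "n + (1 + norm h * norm h) / n \<le> 2 + 4 * (norm h * norm h)"
    proof -
      have "(n - 1) * (n - 1) \<le> norm h * norm h"
        using n1 by (metis abs_ge_zero abs_mult_self_eq mult_mono norm_ge_zero)
      moreover have "2 * (norm h * norm h) \<le> n * (4 * (norm h * norm h))"
        using n mult_right_mono[of "1/2" n "4 * (norm h * norm h)"] by simp
      ultimately have "n * n + (1 + norm h * norm h) \<le> n * (2 + 4 * (norm h * norm h))"
        by (simp add: algebra_simps)
      then show ?thesis using n by (simp add: field_simps)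
    qed
    moreover have "4 * (norm h * norm h) \<le> \<epsilon> / 2 * norm h"
      using hb mult_right_mono[of "norm h" "\<epsilon>/8" "norm h"] by simp
    ultimately show ?thesis unfolding n_def by linarith
  qed
  ultimately show ?thesis by (auto intro!: exI[of _ \<delta>])
qed

text \<open>The one-sided directional derivative of the norm: the quotients decrease as \<open>t\<close> decreases
  to \<open>0\<close>, so the infimum is their limit.\<close>

definition norm_slope :: "'a::real_normed_vector \<Rightarrow> 'a \<Rightarrow> real" where
  "norm_slope x h = (INF t\<in>{0<..}. (norm (x + t *\<^sub>R h) - norm x) / t)"

text \<open>Bounds the quotients from below, so that the real infimum in \<open>norm_slope\<close>
  is a genuine greatest lower bound.\<close>

lemma norm_slope_lower:
  fixes x h :: "'a::real_normed_vector"
  assumes "t > 0"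
  shows "- norm h \<le> (norm (x + t *\<^sub>R h) - norm x) / t"
proof -
  have "norm x \<le> norm (x + t *\<^sub>R h) + t * norm h"
    using norm_triangle_ineq4[of "x + t *\<^sub>R h" "t *\<^sub>R h"] assms by simp
  then show ?thesis using assms by (simp add: field_simps)
qed

lemma norm_slope_le:
  assumes "t > 0"
  shows "norm_slope x h \<le> (norm (x + t *\<^sub>R h) - norm x) / t"
  unfolding norm_slope_def using assms
  by (intro cINF_lower bdd_belowI2[of _ "- norm h"] norm_slope_lower) auto

lemma norm_slope_greatest:
  assumes "\<And>t. t > 0 \<Longrightarrow> c \<le> (norm (x + t *\<^sub>R h) - norm x) / t"
  shows "c \<le> norm_slope x h"
  unfolding norm_slope_def using assms by (intro cINF_greatest) auto

text \<open>Convexity of the norm: \<open>x + s h\<close> lies on the segment from \<open>x\<close>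
  to \<open>x + t h\<close>.\<close>

lemma norm_quotient_mono:
  fixes x h :: "'a::real_normed_vector"
  assumes "0 < s" "s \<le> t"
  shows "(norm (x + s *\<^sub>R h) - norm x) / s \<le> (norm (x + t *\<^sub>R h) - norm x) / t"
proof -
  have "t *\<^sub>R (x + s *\<^sub>R h) = s *\<^sub>R (x + t *\<^sub>R h) + (t - s) *\<^sub>R x"
    by (simp add: algebra_simps)
  then have "norm (t *\<^sub>R (x + s *\<^sub>R h)) \<le> norm (s *\<^sub>R (x + t *\<^sub>R h)) + norm ((t - s) *\<^sub>R x)"
    by (metis norm_triangle_ineq)
  then have "t * norm (x + s *\<^sub>R h) \<le> s * norm (x + t *\<^sub>R h) + (t - s) * norm x"
    using assms by simp
  then show ?thesis using assms by (simp add: field_simps)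
qed

text \<open>The point \<open>x + r (h + k)\<close> is the midpoint of \<open>x + 2 r h\<close> and
  \<open>x + 2 r k\<close>. Independent steps \<open>s\<close> and \<open>t\<close> allow the two
  infima to be taken one after the other; monotonicity of the quotients reduces both to the common
  step \<open>2 r\<close>.\<close>

lemma norm_slope_add_le: "norm_slope x (h + k) \<le> norm_slope x h + norm_slope x k"
proof -
  have *: "norm_slope x (h + k) \<le> (norm (x + s *\<^sub>R h) - norm x) / s + (norm (x + t *\<^sub>R k) - norm x) / t"
    if "s > 0" "t > 0" for s t
  proof -
    define r where "r = min s t / 2"
    have r: "r > 0" "2 * r \<le> s" "2 * r \<le> t" using that by (auto simp: r_def)
    have "2 *\<^sub>R (x + r *\<^sub>R (h + k)) = (x + (2 * r) *\<^sub>R h) + (x + (2 * r) *\<^sub>R k)"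
      by (simp add: algebra_simps scaleR_2)
    then have "2 * norm (x + r *\<^sub>R (h + k)) \<le> norm (x + (2 * r) *\<^sub>R h) + norm (x + (2 * r) *\<^sub>R k)"
      by (metis abs_numeral norm_scaleR norm_triangle_ineq)
    then have "(norm (x + r *\<^sub>R (h + k)) - norm x) / r
        \<le> (norm (x + (2 * r) *\<^sub>R h) - norm x) / (2 * r) + (norm (x + (2 * r) *\<^sub>R k) - norm x) / (2 * r)"
      using r by (simp add: divide_le_eq flip: add_divide_distrib)
    also have "\<dots> \<le> (norm (x + s *\<^sub>R h) - norm x) / s + (norm (x + t *\<^sub>R k) - norm x) / t"
      using r by (intro add_mono norm_quotient_mono) auto
    finally show ?thesis using norm_slope_le[OF r(1), of x "h + k"] by linarith
  qed
  have "norm_slope x (h + k) - norm_slope x k \<le> norm_slope x h"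
  proof (rule norm_slope_greatest)
    fix s :: real assume s: "s > 0"
    have "norm_slope x (h + k) - (norm (x + s *\<^sub>R h) - norm x) / s \<le> norm_slope x k"
      by (rule norm_slope_greatest) (use *[OF s] in \<open>simp add: algebra_simps\<close>)
    then show "norm_slope x (h + k) - norm_slope x k \<le> (norm (x + s *\<^sub>R h) - norm x) / s" by simp
  qed
  then show ?thesis by simp
qed

lemma norm_slope_scaleR_le:
  assumes "r > 0"
  shows "r * norm_slope x h \<le> norm_slope x (r *\<^sub>R h)"
proof (rule norm_slope_greatest)
  fix t :: real assume "t > 0"
  then show "r * norm_slope x h \<le> (norm (x + t *\<^sub>R r *\<^sub>R h) - norm x) / t"
    using norm_slope_le[of "t * r" x h] assms by (simp add: field_simps)
qed

lemma norm_slope_0: "norm_slope x 0 = 0"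
  by (simp add: norm_slope_def)

lemma norm_slope_minus_ge: "- norm_slope x h \<le> norm_slope x (- h)"
  using norm_slope_add_le[of x h "- h"] by (simp add: norm_slope_0)

text \<open>The slope is always sublinear in the direction. Small second differences also make it
  odd, hence linear, so it is the derivative.\<close>

lemma uniformly_smoothI:
  assumes second_difference: "\<And>\<epsilon>. \<epsilon> > 0 \<Longrightarrow> \<exists>\<delta>>0. \<forall>x \<in> sphere (0::'a::real_normed_vector) 1. \<forall>h.
     norm h < \<delta> \<longrightarrow> norm (x + h) + norm (x - h) \<le> 2 + \<epsilon> * norm h"
  shows "uniformly_smooth TYPE('a)"
proof -
  have minus: "norm_slope x (- h) = - norm_slope x h" if x: "x \<in> sphere 0 1" for x h :: 'a
  proof -
    have "norm_slope x (- h) + norm_slope x h \<le> e" if e: "e > 0" for e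
    proof -
      \<comment> \<open>The summand 1 keeps the denominator positive when \<open>h = 0\<close>, here
        and in \<open>t\<close>.\<close>
      define \<epsilon> where "\<epsilon> = e / (norm h + 1)"
      have "\<epsilon> > 0" using e by (simp add: \<epsilon>_def add_nonneg_pos)
      then obtain \<delta> where "\<delta> > 0" and d: "\<And>h. norm h < \<delta> \<Longrightarrow> norm (x + h) + norm (x - h) \<le> 2 + \<epsilon> * norm h"
        using second_difference[of \<epsilon>] x by blast
      define t where "t = \<delta> / (norm h + 1)"
      have t: "t > 0" using \<open>\<delta> > 0\<close> by (simp add: t_def add_nonneg_pos)
      have "t * norm h < t * (norm h + 1)" using t by simp
      also have "\<dots> = \<delta>" unfolding t_def by (simp add: add_nonneg_eq_0_iff)
      finally have "norm (x + t *\<^sub>R h) + norm (x - t *\<^sub>R h) \<le> 2 + \<epsilon> * (t * norm h)"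
        using d[of "t *\<^sub>R h"] t by simp
      then have "((norm (x + t *\<^sub>R h) - 1) + (norm (x - t *\<^sub>R h) - 1)) / t \<le> \<epsilon> * norm h"
        using t by (simp add: divide_le_eq mult.commute mult.left_commute)
      then have "(norm (x + t *\<^sub>R h) - 1) / t + (norm (x - t *\<^sub>R h) - 1) / t \<le> \<epsilon> * norm h"
        by (simp add: add_divide_distrib diff_divide_distrib)
      moreover have "\<epsilon> * norm h \<le> e"
        using e by (simp add: \<epsilon>_def divide_le_eq add_nonneg_pos)
      moreover have "norm x = 1" using x by simp
      ultimately show ?thesis
        using norm_slope_le[OF t, of x h] norm_slope_le[OF t, of x "- h"] by simp
    qed
    then have "norm_slope x (- h) + norm_slope x h \<le> 0"
      by (rule field_le_epsilon) simp
    then show ?thesis using norm_slope_minus_ge[of x h] by linarith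
  qed
  have add: "norm_slope x (h + k) = norm_slope x h + norm_slope x k" if x: "x \<in> sphere 0 1" for x h k :: 'a
    \<comment> \<open>By oddness, subadditivity at \<open>- h\<close> and \<open>- k\<close> is the
      reverse inequality.\<close>
    using norm_slope_add_le[of x h k] norm_slope_add_le[of x "- h" "- k"]
      minus[OF x, of h] minus[OF x, of k] minus[OF x, of "h + k"] by simp
  have scale_pos: "norm_slope x (r *\<^sub>R h) = r * norm_slope x h" if "r > 0" for x h :: 'a and r
    using norm_slope_scaleR_le[OF that, of x h] norm_slope_scaleR_le[of "inverse r" x "r *\<^sub>R h"] that
    by (simp add: field_simps)
  have upper: "norm_slope x h \<le> norm (x + h) - 1" if "x \<in> sphere 0 1" for x h :: 'a
    using norm_slope_le[of 1 x h] that by simp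
  have bl: "bounded_linear (norm_slope x)" if x: "x \<in> sphere 0 1" for x :: 'a
  proof (rule bounded_linear_intro[where K = 1])
    show "norm_slope x (h + k) = norm_slope x h + norm_slope x k" for h k by (rule add[OF x])
    show "norm_slope x (r *\<^sub>R h) = r *\<^sub>R norm_slope x h" for r h
      using scale_pos[of r x h] scale_pos[of "- r" x h] minus[OF x, of "r *\<^sub>R h"]
      by (cases "r = 0"; cases "r > 0") (auto simp: norm_slope_0)
    show "norm (norm_slope x h) \<le> norm h * 1" for h
      using upper[OF x, of h] upper[OF x, of "- h"] minus[OF x, of h] x
        norm_triangle_ineq[of x h] norm_triangle_ineq4[of x h] by (simp add: abs_le_iff)
  qed
  have remainder: "\<exists>\<delta>>0. \<forall>x \<in> sphere (0::'a) 1. \<forall>h. norm h < \<delta> \<longrightarrow>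
      \<bar>norm (x + h) - norm x - norm_slope x h\<bar> \<le> \<epsilon> * norm h" if e: "\<epsilon> > 0" for \<epsilon>
  proof -
    obtain \<delta> where \<delta>: "\<delta> > 0" "\<forall>x \<in> sphere (0::'a) 1. \<forall>h. norm h < \<delta> \<longrightarrow>
        norm (x + h) + norm (x - h) \<le> 2 + \<epsilon> * norm h"
      using second_difference[OF e] by blast
    have "\<bar>norm (x + h) - norm x - norm_slope x h\<bar> \<le> \<epsilon> * norm h"
      if x: "x \<in> sphere 0 1" and h: "norm h < \<delta>" for x h :: 'a
    proof -
      have "norm (x + h) + norm (x - h) \<le> 2 + \<epsilon> * norm h" using \<delta>(2) x h by blast
      moreover have "norm x = 1" using x by simp
      \<comment> \<open>The remainders at \<open>h\<close> and \<open>- h\<close> are nonnegative by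
        \<open>upper\<close>, and by oddness of the slope they add up to the second difference, so
        each is at most \<open>\<epsilon> * norm h\<close>.\<close>
      ultimately show ?thesis
        using upper[OF x, of h] upper[OF x, of "- h"] minus[OF x, of h] by simp
    qed
    then show ?thesis using \<delta>(1) by blast
  qed
  have "(norm has_derivative norm_slope x) (at x)" if x: "x \<in> sphere 0 1" for x :: 'a
    unfolding has_derivative_at_alt
  proof (intro conjI allI impI bl[OF x])
    fix e :: real assume "e > 0"
    then obtain d where "d > 0" and d: "\<And>h. norm h < d \<Longrightarrow>
        \<bar>norm (x + h) - norm x - norm_slope x h\<bar> \<le> e * norm h"
      using remainder x by blast
    have "norm (norm y - norm x - norm_slope x (y - x)) \<le> e * norm (y - x)" if "norm (y - x) < d" for y
      using d[OF that] by simp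
    then show "\<exists>d>0. \<forall>y. norm (y - x) < d \<longrightarrow> norm (norm y - norm x - norm_slope x (y - x)) \<le> e * norm (y - x)"
      using \<open>d > 0\<close> by blast
  qed
  then show ?thesis
    unfolding uniformly_smooth_def using remainder by (intro exI[of _ norm_slope] conjI ballI allI impI)
qed

section \<open>Second differences and norming functionals in uniformly smooth spaces\<close>

lemma uniformly_smoothE:
  assumes "uniformly_smooth TYPE('a::real_normed_vector)"
  obtains D :: "'a::real_normed_vector \<Rightarrow> 'a \<Rightarrow> real" where "\<And>x. norm x = 1 \<Longrightarrow> (norm has_derivative D x) (at x)"
    "\<And>\<epsilon>. \<epsilon> > 0 \<Longrightarrow> \<exists>\<delta>>0. \<forall>x h. norm x = 1 \<longrightarrow> norm h < \<delta> \<longrightarrow>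
       \<bar>norm (x + h) - norm x - D x h\<bar> \<le> \<epsilon> * norm h"
proof -
  from assms obtain D :: "'a \<Rightarrow> 'a \<Rightarrow> real" where
    D: "\<forall>x \<in> sphere 0 1. (norm has_derivative D x) (at x)" and
    D': "\<forall>\<epsilon> > 0. \<exists>\<delta> > 0. \<forall>x \<in> sphere 0 1. \<forall>h. norm h < \<delta> \<longrightarrow>
           \<bar>norm (x + h) - norm x - D x h\<bar> \<le> \<epsilon> * norm h"
    unfolding uniformly_smooth_def by (elim exE conjE)
  show ?thesis
  proof (rule that)
    show "(norm has_derivative D x) (at x)" if "norm x = 1" for x
      using bspec[OF D, of x] that by simp
    show "\<exists>\<delta>>0. \<forall>x h. norm x = 1 \<longrightarrow> norm h < \<delta> \<longrightarrow>
        \<bar>norm (x + h) - norm x - D x h\<bar> \<le> \<epsilon> * norm h" if "\<epsilon> > 0" for \<epsilon>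
      using D'[rule_format, OF that] unfolding Ball_def mem_sphere_0 by meson
  qed
qed

lemma uniformly_smooth_second_difference:
  assumes "uniformly_smooth TYPE('a::real_normed_vector)" and "\<epsilon> > 0"
  obtains \<delta> where "\<delta> > 0"
    "\<And>x h. norm (x::'a) = 1 \<Longrightarrow> norm h < \<delta> \<Longrightarrow> norm (x + h) + norm (x - h) \<le> 2 + \<epsilon> * norm h"
proof (rule uniformly_smoothE[OF assms(1)])
  fix D :: "'a \<Rightarrow> 'a \<Rightarrow> real"
  assume D: "\<And>x. norm x = 1 \<Longrightarrow> (norm has_derivative D x) (at x)"
    and ex: "\<And>\<epsilon>. \<epsilon> > 0 \<Longrightarrow> \<exists>\<delta>>0. \<forall>x h. norm x = 1 \<longrightarrow> norm h < \<delta> \<longrightarrow>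
       \<bar>norm (x + h) - norm x - D x h\<bar> \<le> \<epsilon> * norm h"
  from ex[OF half_gt_zero[OF assms(2)]] obtain \<delta> where \<delta>: "\<delta> > 0"
    "\<And>x h. norm x = 1 \<Longrightarrow> norm h < \<delta> \<Longrightarrow> \<bar>norm (x + h) - norm x - D x h\<bar> \<le> \<epsilon> / 2 * norm h"
    by meson
  have "norm (x + h) + norm (x - h) \<le> 2 + \<epsilon> * norm h" if "norm x = 1" "norm h < \<delta>" for x h :: 'a
  proof -
    have "D x (- h) = - D x h"
      using D[OF that(1)] has_derivative_linear linear_neg by blast
    then show ?thesis
      using \<delta>(2)[OF that] \<delta>(2)[of x "- h"] that
        abs_ge_self[of "norm (x + h) - 1 - D x h"] abs_ge_self[of "norm (x - h) - 1 + D x h"]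
      by simp
  qed
  with \<delta>(1) that show ?thesis by blast
qed

text \<open>Differentiability replaces Hahn-Banach: the derivative of the norm at
  \<open>sgn u\<close> is the functional. The triangle inequality bounds its difference quotients by
  \<open>norm h\<close>, and along \<open>sgn u\<close> itself they equal 1.\<close>

lemma uniformly_smooth_norming_functional:
  fixes u :: "'a::real_normed_vector"
  assumes "uniformly_smooth TYPE('a)"
  obtains g :: "'a \<Rightarrow>\<^sub>L real" where "norm g \<le> 1" "blinfun_apply g u = norm u"
proof (cases "u = 0")
  case True
  then show ?thesis using that[of 0] by simp
next
  case False
  define x where "x = sgn u"
  have x: "norm x = 1" using False by (simp add: x_def norm_sgn)
  obtain D :: "'a \<Rightarrow> real" where D: "(norm has_derivative D) (at x)"
    using uniformly_smoothE[OF assms] x by metis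
  have lim: "((\<lambda>t. (norm (x + t *\<^sub>R h) - norm x) / t) \<longlongrightarrow> D h) (at 0)" for h
  proof -
    have "((\<lambda>t. norm (x + t *\<^sub>R h)) has_derivative (\<lambda>t. D (t *\<^sub>R h))) (at 0)"
      by (rule has_derivative_compose[of "\<lambda>t. x + t *\<^sub>R h" "\<lambda>t. t *\<^sub>R h" 0 UNIV norm D])
        (use D in \<open>auto intro!: derivative_eq_intros\<close>)
    moreover have "(\<lambda>t. D (t *\<^sub>R h)) = (*) (D h)"
      using linear_scale[OF has_derivative_linear[OF D]] by (auto simp: mult.commute)
    ultimately have "((\<lambda>t. norm (x + t *\<^sub>R h)) has_field_derivative D h) (at 0)"
      by (simp add: has_field_derivative_def)
    then show ?thesis by (simp add: DERIV_def)
  qed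
  have "D h \<le> norm h" for h
  proof (rule tendsto_upperbound[OF tendsto_within_subset[OF lim[of h], of "{0<..}"]])
    have "(norm (x + t *\<^sub>R h) - norm x) / t \<le> norm h" if "t > 0" for t
      using norm_triangle_ineq[of x "t *\<^sub>R h"] that by (simp add: divide_le_eq mult.commute)
    then show "\<forall>\<^sub>F t in at_right 0. (norm (x + t *\<^sub>R h) - norm x) / t \<le> norm h"
      by (auto simp: eventually_at_filter)
  qed auto
  then have "norm (D h) \<le> 1 * norm h" for h
    using linear_neg[OF has_derivative_linear[OF D], of h] by (metis abs_le_iff mult_1 norm_minus_cancel real_norm_def)
  moreover have "D x = 1"
  proof -
    have "((\<lambda>t. (norm (x + t *\<^sub>R x) - norm x) / t) \<longlongrightarrow> 1) (at 0)"
    proof (rule tendsto_eventually)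
      have "(norm (x + t *\<^sub>R x) - norm x) / t = 1" if "t \<noteq> 0" "dist t 0 < 1" for t
      proof -
        have "norm ((1 + t) *\<^sub>R x) = 1 + t" using that x by (simp add: dist_real_def)
        then show ?thesis using that x by (simp add: scaleR_left_distrib)
      qed
      then show "\<forall>\<^sub>F t in at 0. (norm (x + t *\<^sub>R x) - norm x) / t = 1"
        unfolding eventually_at by (intro exI[of _ 1]) auto
    qed
    then show ?thesis using lim[of x] LIM_unique by blast
  qed
  moreover have "D u = norm u * D x"
    using linear_scale[OF has_derivative_linear[OF D], of "norm u" x] False
    by (simp add: x_def sgn_div_norm)
  ultimately show ?thesis
    using that[of "Blinfun D"] has_derivative_bounded_linear[OF D]
    by (simp add: bounded_linear_Blinfun_apply norm_blinfun_bound)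
qed

subsection \<open>Slices of the unit ball\<close>

text \<open>The functional is not normalised and \<open>\<alpha>\<close> is arbitrary, so a slice
  may be empty, and the zero functional with a negative \<open>\<alpha>\<close> cuts out the whole
  ball.\<close>

definition ball_slice :: "('a::real_normed_vector \<Rightarrow>\<^sub>L real) \<Rightarrow> real \<Rightarrow> 'a set" where
  "ball_slice f \<alpha> = {z \<in> cball 0 1. \<alpha> < blinfun_apply f z}"

text \<open>The vector \<open>e\<close> rules out the zero space, whose sphere is empty. Testing a
  failing bound at \<open>e\<close> and \<open>- e\<close> shows \<open>norm f - \<eta>\<close> to
  be nonnegative, so it could serve as an operator bound for \<open>f\<close>.\<close>

lemma blinfun_almost_norming:
  fixes f :: "'a::real_normed_vector \<Rightarrow>\<^sub>L real"
  assumes "norm (e::'a) = 1" and "\<eta> > 0"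
  obtains x where "norm x = 1" "norm f - \<eta> < blinfun_apply f x"
proof (rule ccontr)
  assume "\<not> thesis"
  with that have le: "blinfun_apply f x \<le> norm f - \<eta>" if "norm x = 1" for x
    using \<open>norm x = 1\<close> by (meson not_le)
  have "0 \<le> norm f - \<eta>"
    using le[of e] le[of "- e"] assms(1) by (simp add: blinfun.minus_right)
  moreover have "norm (blinfun_apply f x) \<le> (norm f - \<eta>) * norm x" for x
  proof (cases "x = 0")
    case False
    then have "blinfun_apply f (sgn x) \<le> norm f - \<eta>" "blinfun_apply f (- sgn x) \<le> norm f - \<eta>"
      by (auto intro!: le simp: norm_sgn)
    then have "\<bar>blinfun_apply f x / norm x\<bar> \<le> norm f - \<eta>"
      by (simp add: sgn_div_norm blinfun.minus_right blinfun.scaleR_right divide_inverse mult.commute)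
    then show ?thesis using False by (simp add: divide_le_eq abs_divide)
  qed simp
  ultimately have "norm f \<le> norm f - \<eta>" by (rule norm_blinfun_bound)
  then show False using assms(2) by simp
qed

lemma blinfun_le_norm:
  fixes f :: "'a::real_normed_vector \<Rightarrow>\<^sub>L real"
  assumes "norm z \<le> 1"
  shows "blinfun_apply f z \<le> norm f"
  using norm_blinfun[of f z] mult_left_mono[OF assms, of "norm f"] by simp

text \<open>The subslice is cut out by a small perturbation of \<open>f\<close> in the direction of a functional
  norming \<open>u - p\<close>, where \<open>u\<close> is a point far from \<open>p\<close> at which \<open>f\<close> almost attains its norm.\<close>

lemma subslice_away_from_point:
  fixes f :: "'a::real_normed_vector \<Rightarrow>\<^sub>L real" and p :: 'a
  assumes "uniformly_smooth TYPE('a)" and e: "norm (e::'a) = 1"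
    and large: "\<And>(f :: 'a \<Rightarrow>\<^sub>L real) \<alpha>. ball_slice f \<alpha> \<noteq> {} \<Longrightarrow> \<not> ball_slice f \<alpha> \<subseteq> cball p r"
    and ne: "ball_slice f \<alpha> \<noteq> {}" and \<theta>: "0 < \<theta>" "\<theta> \<le> 1"
  obtains f' \<alpha>' g where "ball_slice f' \<alpha>' \<noteq> {}" "ball_slice f' \<alpha>' \<subseteq> ball_slice f \<alpha>"
    "norm (g :: 'a \<Rightarrow>\<^sub>L real) \<le> 1"
    "\<And>z. z \<in> ball_slice f' \<alpha>' \<Longrightarrow> r - \<theta> < blinfun_apply g (z - p)"
proof -
  obtain z0 where z0: "norm z0 \<le> 1" "\<alpha> < blinfun_apply f z0"
    using ne by (auto simp: ball_slice_def)
  define \<tau> where "\<tau> = norm f - \<alpha>"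
  have \<tau>: "\<tau> > 0" using blinfun_le_norm[OF z0(1), of f] z0(2) by (simp add: \<tau>_def)
  \<comment> \<open>On the subslice \<open>f\<close> stays above
    \<open>norm f - 2 * \<eta> - 2 * s\<close>, because \<open>g\<close> varies by at most 2 on the
    ball. With \<open>2 * \<eta> \<le> s\<close> this loses at most \<open>3 * s\<close>, less than
    \<open>\<tau>\<close>. The choice of \<open>\<eta>\<close> makes the loss in \<open>g\<close>,
    namely \<open>2 * \<eta> / s\<close>, equal to \<open>\<theta>\<close>.\<close>
  define s where "s = \<tau> / 4"
  have s: "s > 0" using \<tau> by (simp add: s_def)
  define \<eta> where "\<eta> = s * \<theta> / 2"
  have \<eta>: "\<eta> > 0" using s \<theta> by (simp add: \<eta>_def)
  have s\<theta>: "2 * \<eta> = s * \<theta>" "s * \<theta> \<le> s" using s \<theta> by (simp_all add: \<eta>_def)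
  obtain z1 where "norm z1 = 1" "norm f - \<eta> < blinfun_apply f z1"
    using blinfun_almost_norming[OF e \<eta>] by blast
  then have "ball_slice f (norm f - \<eta>) \<noteq> {}" by (auto simp: ball_slice_def intro!: exI[of _ z1])
  then obtain u where u: "norm u \<le> 1" "norm f - \<eta> < blinfun_apply f u" "norm (u - p) > r"
    using large by (fastforce simp: ball_slice_def dist_norm norm_minus_commute)
  obtain g :: "'a \<Rightarrow>\<^sub>L real" where g: "norm g \<le> 1" "blinfun_apply g (u - p) = norm (u - p)"
    using uniformly_smooth_norming_functional[OF assms(1)] .
  define f' where "f' = f + s *\<^sub>R g"
  define \<alpha>' where "\<alpha>' = blinfun_apply f' u - \<eta>"
  have z: "r - \<theta> < blinfun_apply g (z - p)" "\<alpha> < blinfun_apply f z"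
    if "norm z \<le> 1" "\<alpha>' < blinfun_apply f' z" for z
  proof -
    have *: "norm f - 2 * \<eta> + s * blinfun_apply g u < blinfun_apply f z + s * blinfun_apply g z"
      using that(2) u(2) by (simp add: \<alpha>'_def f'_def blinfun.add_left blinfun.scaleR_left)
    then have "s * (blinfun_apply g u - \<theta>) < s * blinfun_apply g z"
      using blinfun_le_norm[OF that(1), of f] s\<theta> by (simp add: algebra_simps)
    then have "blinfun_apply g u - \<theta> < blinfun_apply g z" using s by simp
    then show "r - \<theta> < blinfun_apply g (z - p)"
      using g(2) u(3) by (simp add: blinfun.diff_right)
    have "blinfun_apply g z \<le> 1" "- blinfun_apply g u \<le> 1"
      using blinfun_le_norm[OF that(1), of g] blinfun_le_norm[of "- u" g] u(1) g(1)
      by (auto simp: blinfun.minus_right)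
    then have "s * blinfun_apply g z \<le> s" "- s \<le> s * blinfun_apply g u"
      using s mult_left_mono[of "blinfun_apply g z" 1 s] mult_left_mono[of "-1" "blinfun_apply g u" s] by auto
    moreover have "norm f = \<alpha> + 4 * s" by (simp add: s_def \<tau>_def field_simps)
    ultimately show "\<alpha> < blinfun_apply f z"
      using * s\<theta> \<tau> s by linarith
  qed
  have "u \<in> ball_slice f' \<alpha>'" using u(1) \<eta> by (simp add: ball_slice_def \<alpha>'_def)
  with z g(1) show ?thesis
    by (intro that[of f' \<alpha>' g]) (auto simp: ball_slice_def)
qed

lemma uniformly_smooth_small_slice:
  fixes e :: "'a::real_normed_vector"
  assumes smooth: "uniformly_smooth TYPE('a)" and e: "norm e = 1" and "r > 0"
  obtains f :: "'a \<Rightarrow>\<^sub>L real" and \<alpha> c where "ball_slice f \<alpha> \<noteq> {}" "ball_slice f \<alpha> \<subseteq> cball c r"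
proof (rule ccontr)
  assume "\<not> thesis"
  with that have no_small: "\<not> ball_slice f \<alpha> \<subseteq> cball c r"
    if "ball_slice f \<alpha> \<noteq> {}" for f :: "'a \<Rightarrow>\<^sub>L real" and \<alpha> c
    using \<open>ball_slice f \<alpha> \<noteq> {}\<close> by blast
  define P where "P = {\<rho>. \<exists>(f :: 'a \<Rightarrow>\<^sub>L real) \<alpha> c. ball_slice f \<alpha> \<noteq> {} \<and> ball_slice f \<alpha> \<subseteq> cball c \<rho>}"
  define R where "R = Inf P"
  have P_ge: "r \<le> \<rho>" if \<rho>: "\<rho> \<in> P" for \<rho>
  proof (rule ccontr)
    assume "\<not> r \<le> \<rho>"
    then have "cball c \<rho> \<subseteq> cball c r" for c :: 'a by auto
    then show False using \<rho> no_small unfolding P_def by blast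
  qed
  have bdd: "bdd_below P" using P_ge by (rule bdd_belowI)
  \<comment> \<open>The whole ball counts as a slice, so \<open>P\<close> is nonempty.\<close>
  have "ball_slice (0 :: 'a \<Rightarrow>\<^sub>L real) (-1) = cball 0 1" by (auto simp: ball_slice_def)
  then have "1 \<in> P"
    unfolding P_def mem_Collect_eq by (intro exI[of _ "0 :: 'a \<Rightarrow>\<^sub>L real"] exI[of _ "-1"] exI[of _ 0]) simp
  then have R: "R \<ge> r" unfolding R_def using P_ge by (intro cInf_greatest) auto
  have large: "\<not> ball_slice f \<alpha> \<subseteq> cball c (R - \<theta>)"
    if "\<theta> > 0" "ball_slice f \<alpha> \<noteq> {}" for f :: "'a \<Rightarrow>\<^sub>L real" and \<alpha> c \<theta>
  proof
    assume "ball_slice f \<alpha> \<subseteq> cball c (R - \<theta>)"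
    then have "R - \<theta> \<in> P" using that(2) unfolding P_def by blast
    then have "R \<le> R - \<theta>" unfolding R_def using bdd by (rule cInf_lower)
    then show False using that(1) by simp
  qed
  obtain \<delta> where \<delta>: "\<delta> > 0" "\<And>x h. norm (x::'a) = 1 \<Longrightarrow> norm h < \<delta> \<Longrightarrow>
      norm (x + h) + norm (x - h) \<le> 2 + 1/4 * norm h"
    using uniformly_smooth_second_difference[OF smooth, of "1/4"] by auto
  \<comment> \<open>The increment \<open>h\<close> below has norm at most \<open>2 * s\<close>, so
    \<open>\<delta> / 4\<close> keeps it in the range of the smoothness estimate.\<close>
  define s where "s = min (1/2) (\<delta> / 4)"
  have s: "0 < s" "s \<le> 1/2" "s \<le> \<delta>/4" using \<delta>(1) by (auto simp: s_def)
  \<comment> \<open>The lower bounds on the norms of \<open>b \<plusminus> s a\<close> exceed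
    \<open>2 * R\<close> by about \<open>s * R\<close> in total, whereas smoothness permits about
    \<open>s * R / 4\<close>. The errors add up to less than \<open>8 * \<theta>\<close>, which is
    below the gap.\<close>
  define \<theta> where "\<theta> = min 1 (s * R / 20)"
  have Rp: "R > 0" using R \<open>r > 0\<close> by linarith
  have \<theta>: "0 < \<theta>" "\<theta> \<le> 1" "20 * \<theta> \<le> s * R" using s Rp by (auto simp: \<theta>_def)
  have sR: "s * R \<le> R / 2" using s Rp mult_right_mono[of s "1/2" R] by simp
  have "\<exists>\<rho>\<in>P. \<rho> < R + \<theta>"
    using \<open>1 \<in> P\<close> \<theta>(1) cInf_lessD[of P "R + \<theta>"] by (auto simp: R_def)
  then obtain \<rho> c and f0 :: "'a \<Rightarrow>\<^sub>L real" and \<alpha>0 where \<rho>: "\<rho> < R + \<theta>"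
    and S0: "ball_slice f0 \<alpha>0 \<noteq> {}" "ball_slice f0 \<alpha>0 \<subseteq> cball c \<rho>"
    unfolding P_def by blast
  \<comment> \<open>One \<open>\<theta>\<close> is lost because slices are only known to leave balls
    of radius \<open>R - \<theta>\<close>, the other in passing to the subslice.\<close>
  obtain f1 \<alpha>1 and g0 :: "'a \<Rightarrow>\<^sub>L real" where S1: "ball_slice f1 \<alpha>1 \<noteq> {}" "ball_slice f1 \<alpha>1 \<subseteq> ball_slice f0 \<alpha>0"
    "norm g0 \<le> 1" "\<And>z. z \<in> ball_slice f1 \<alpha>1 \<Longrightarrow> R - \<theta> - \<theta> < blinfun_apply g0 (z - c)"
    using subslice_away_from_point[OF smooth e large[OF \<theta>(1)] S0(1) \<theta>(1,2)] by blast
  then obtain z1 where z1: "z1 \<in> ball_slice f1 \<alpha>1" by blast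
  define a where "a = z1 - c"
  \<comment> \<open>The point to be avoided is shifted from \<open>c\<close> to
    \<open>c + s a\<close>, which makes \<open>b - s a\<close> long; \<open>g0\<close> remains large
    at \<open>b\<close> because the slices are nested.\<close>
  obtain f2 \<alpha>2 and g1 :: "'a \<Rightarrow>\<^sub>L real" where S2: "ball_slice f2 \<alpha>2 \<noteq> {}" "ball_slice f2 \<alpha>2 \<subseteq> ball_slice f1 \<alpha>1"
    "norm g1 \<le> 1" "\<And>z. z \<in> ball_slice f2 \<alpha>2 \<Longrightarrow> R - \<theta> - \<theta> < blinfun_apply g1 (z - (c + s *\<^sub>R a))"
    using subslice_away_from_point[OF smooth e large[OF \<theta>(1)] S1(1) \<theta>(1,2)] by blast
  then obtain z2 where z2: "z2 \<in> ball_slice f2 \<alpha>2" by blast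
  define b where "b = z2 - c"
  have ab: "norm a \<le> R + \<theta>" "norm b \<le> R + \<theta>"
    using z1 z2 S0(2) S1(2) S2(2) \<rho> unfolding a_def b_def
    by (fastforce simp: dist_norm norm_minus_commute)+
  have g0: "R - 2 * \<theta> < blinfun_apply g0 a" "R - 2 * \<theta> < blinfun_apply g0 b"
    using S1(4)[OF z1] S1(4)[of z2] S2(2) z2 by (auto simp: a_def b_def)
  have le: "blinfun_apply g x \<le> norm x" if "norm g \<le> 1" for g :: "'a \<Rightarrow>\<^sub>L real" and x
    using norm_blinfun[of g x] mult_right_mono[OF that, of "norm x"] by simp
  have "blinfun_apply g1 (b - s *\<^sub>R a) > R - 2 * \<theta>"
    using S2(4)[OF z2] by (simp add: b_def algebra_simps)
  then have minus: "norm (b - s *\<^sub>R a) > R - 2 * \<theta>" using le[OF S2(3), of "b - s *\<^sub>R a"] by linarith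
  have "s * (R - 2 * \<theta>) \<le> s * blinfun_apply g0 a" using s g0 by simp
  then have plus: "norm (b + s *\<^sub>R a) > R - 2 * \<theta> + s * (R - 2 * \<theta>)"
    using le[OF S1(3), of "b + s *\<^sub>R a"] g0
    by (simp add: blinfun.add_right blinfun.scaleR_right)
  define n where "n = norm b"
  have n: "R - 2 * \<theta> < n" "n > 0" using le[OF S1(3), of b] g0 \<theta> sR Rp unfolding n_def by linarith+
  define h where "h = (s / n) *\<^sub>R a"
  have nh: "norm h = s * norm a / n" using s n by (simp add: h_def)
  have "norm a \<le> 2 * n" using ab n \<theta> sR by linarith
  then have "s * norm a \<le> 2 * s * n" using s mult_left_mono[of "norm a" "2 * n" s] by simp
  then have "norm h \<le> 2 * s" using n by (simp add: nh divide_le_eq)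
  then have "norm h < \<delta>" using s \<delta>(1) by linarith
  moreover have "norm (b /\<^sub>R n) = 1" using n by (simp add: n_def)
  ultimately have "norm (b /\<^sub>R n + h) + norm (b /\<^sub>R n - h) \<le> 2 + 1/4 * norm h" using \<delta>(2) by blast
  moreover have "b /\<^sub>R n + h = (b + s *\<^sub>R a) /\<^sub>R n" "b /\<^sub>R n - h = (b - s *\<^sub>R a) /\<^sub>R n"
    by (simp_all add: h_def scaleR_add_right scaleR_diff_right divide_inverse mult.commute)
  moreover have "norm (z /\<^sub>R n) = norm z / n" for z :: 'a
    using n by (simp add: divide_inverse_commute)
  ultimately have "norm (b + s *\<^sub>R a) / n + norm (b - s *\<^sub>R a) / n \<le> 2 + 1/4 * (s * norm a / n)"
    by (metis nh)
  then have "n * (norm (b + s *\<^sub>R a) / n + norm (b - s *\<^sub>R a) / n) \<le> n * (2 + 1/4 * (s * norm a / n))"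
    using n by (intro mult_left_mono) auto
  then have "norm (b + s *\<^sub>R a) + norm (b - s *\<^sub>R a) \<le> 2 * n + 1/4 * (s * norm a)"
    using n by (simp add: distrib_left)
  moreover have "s * norm a \<le> s * (R + \<theta>)" using s ab by simp
  moreover have "s * \<theta> \<le> \<theta> / 2" using s \<theta> mult_right_mono[of s "1/2" \<theta>] by simp
  moreover have "s * (R + \<theta>) = s * R + s * \<theta>" "s * (R - 2 * \<theta>) = s * R - 2 * (s * \<theta>)"
    by (simp_all add: algebra_simps)
  ultimately show False
    using plus minus ab(2) \<theta> mult_nonneg_nonneg[of s \<theta>] s n unfolding n_def[symmetric] by linarith
qed

subsection \<open>Uniform convexity\<close>

text \<open>A quantitative form of midpoint local uniform rotundity. Keeping \<open>x\<close> as the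
  exact midpoint makes it pass through linear contractions.\<close>

definition midpoint_rotund_at :: "'a::real_normed_vector \<Rightarrow> real \<Rightarrow> real \<Rightarrow> bool" where
  "midpoint_rotund_at x r \<eta> \<longleftrightarrow> (\<forall>h. r \<le> norm h \<longrightarrow> 1 + \<eta> \<le> max (norm (x + h)) (norm (x - h)))"

lemma midpoint_rotund_at_minus:
  assumes "midpoint_rotund_at x r \<eta>"
  shows "midpoint_rotund_at (- x) r \<eta>"
  unfolding midpoint_rotund_at_def
proof (intro allI impI)
  fix h :: 'a assume "r \<le> norm h"
  then have "1 + \<eta> \<le> max (norm (x + h)) (norm (x - h))"
    using assms unfolding midpoint_rotund_at_def by blast
  moreover have "norm (- x + h) = norm (x - h)" "norm (- x - h) = norm (x + h)"
    using norm_minus_cancel[of "x - h"] norm_minus_cancel[of "x + h"] by simp_all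
  ultimately show "1 + \<eta> \<le> max (norm (- x + h)) (norm (- x - h))"
    by (simp add: max.commute)
qed

text \<open>If \<open>x\<close> almost maximises the functional of a small slice, then \<open>x \<plusminus> h\<close> can only both be
  close to the ball if both are close to the slice.\<close>

lemma uniformly_smooth_midpoint_rotund:
  fixes e :: "'a::real_normed_vector"
  assumes smooth: "uniformly_smooth TYPE('a)" and e: "norm e = 1" and r: "r > 0"
  obtains x :: 'a and \<eta> where "norm x = 1" "\<eta> > 0" "midpoint_rotund_at x r \<eta>"
proof -
  \<comment> \<open>Two points of a ball of radius \<open>r/3\<close> are at most
    \<open>2 * r / 3\<close> apart, while \<open>x \<plusminus> h\<close>, scaled by
    \<open>1 / (1 + \<eta>)\<close> with \<open>\<eta> \<le> 1\<close>, stay at least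
    \<open>r\<close> apart.\<close>
  obtain f :: "'a \<Rightarrow>\<^sub>L real" and \<alpha> c where S: "ball_slice f \<alpha> \<noteq> {}" "ball_slice f \<alpha> \<subseteq> cball c (r/3)"
    by (rule uniformly_smooth_small_slice[OF smooth e divide_pos_pos[OF r, of 3]]) simp
  define \<tau> where "\<tau> = norm f - \<alpha>"
  have \<tau>: "\<tau> > 0" using S(1) blinfun_le_norm[of _ f] by (fastforce simp: \<tau>_def ball_slice_def)
  \<comment> \<open>The second entry makes inflating the ball by \<open>1 + \<eta>\<close> cheap
    compared with the depth \<open>\<tau>\<close>; the summand 1 covers
    \<open>f = 0\<close>.\<close>
  define \<eta> where "\<eta> = min 1 (\<tau> / (8 * (norm f + 1)))"
  have \<eta>: "\<eta> > 0" "\<eta> \<le> 1" using \<tau> by (auto simp: \<eta>_def add_nonneg_pos)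
  have "\<eta> * (8 * (norm f + 1)) \<le> \<tau>"
    using mult_right_mono[of \<eta> "\<tau> / (8 * (norm f + 1))" "8 * (norm f + 1)"]
      add_nonneg_pos[of "norm f" 1] by (simp add: \<eta>_def)
  then have \<eta>f: "8 * (\<eta> * norm f) \<le> \<tau>" using \<eta>(1) by (simp add: algebra_simps)
  obtain x where x: "norm x = 1" "norm f - \<tau> / 4 < blinfun_apply f x"
    using blinfun_almost_norming[OF e, of "\<tau>/4" f] \<tau> by auto
  \<comment> \<open>As \<open>x\<close> is the midpoint, an upper bound for \<open>f\<close> at
    \<open>x - h\<close> is a lower bound at \<open>x + h\<close>. Replacing \<open>h\<close> by
    \<open>- h\<close> later gives the other point.\<close>
  have in_slice: "(x + h) /\<^sub>R (1 + \<eta>) \<in> ball_slice f \<alpha>"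
    if h: "norm (x + h) < 1 + \<eta>" "norm (x - h) < 1 + \<eta>" for h
  proof -
    have "norm ((x - h) /\<^sub>R (1 + \<eta>)) \<le> 1" using h \<eta> by (simp add: divide_simps)
    from blinfun_le_norm[OF this, of f]
    have "blinfun_apply f (x - h) / (1 + \<eta>) \<le> norm f"
      unfolding blinfun.scaleR_right by (simp add: divide_inverse_commute)
    then have "blinfun_apply f (x - h) \<le> (1 + \<eta>) * norm f"
      using \<eta> by (simp add: divide_le_eq mult.commute)
    then have "blinfun_apply f (x + h) \<ge> 2 * blinfun_apply f x - (1 + \<eta>) * norm f"
      by (simp add: blinfun.add_right blinfun.diff_right)
    moreover have "(1 + \<eta>) * \<alpha> = norm f + \<eta> * norm f - \<tau> - \<eta> * \<tau>" "(1 + \<eta>) * norm f = norm f + \<eta> * norm f"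
      by (simp_all add: \<tau>_def algebra_simps)
    moreover have "\<eta> * \<tau> > 0" using \<eta> \<tau> by simp
    ultimately have "(1 + \<eta>) * \<alpha> < blinfun_apply f (x + h)"
      using x(2) \<eta>f \<tau> by linarith
    then show ?thesis
      using \<eta> h by (simp add: ball_slice_def blinfun.scaleR_right divide_simps mult.commute)
  qed
  have "midpoint_rotund_at x r \<eta>"
    unfolding midpoint_rotund_at_def
  proof (intro allI impI, rule ccontr)
    fix h assume h: "r \<le> norm h" and "\<not> 1 + \<eta> \<le> max (norm (x + h)) (norm (x - h))"
    then have "norm (x + h) < 1 + \<eta>" "norm (x - h) < 1 + \<eta>" by auto
    then have "(x + h) /\<^sub>R (1 + \<eta>) \<in> cball c (r/3)" "(x - h) /\<^sub>R (1 + \<eta>) \<in> cball c (r/3)"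
      using in_slice[of h] in_slice[of "- h"] S(2) by auto
    then have "dist ((x + h) /\<^sub>R (1 + \<eta>)) ((x - h) /\<^sub>R (1 + \<eta>)) \<le> r/3 + r/3"
      by (meson add_mono dist_triangle3 mem_cball order_trans)
    moreover have "(x + h) /\<^sub>R (1 + \<eta>) - (x - h) /\<^sub>R (1 + \<eta>) = (2 / (1 + \<eta>)) *\<^sub>R h"
      by (simp add: scaleR_add_right scaleR_diff_right divide_inverse flip: scaleR_2)
    ultimately have "2 / (1 + \<eta>) * norm h \<le> 2 * r / 3" using \<eta> by (simp add: dist_norm)
    moreover have "1 \<le> 2 / (1 + \<eta>)" using \<eta> by simp
    then have "1 * norm h \<le> 2 / (1 + \<eta>) * norm h" by (intro mult_right_mono) auto
    ultimately show False using h r by simp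
  qed
  with x(1) \<eta>(1) that show ?thesis by blast
qed

text \<open>\<open>T\<close> maps \<open>y \<plusminus> h\<close> to
  \<open>x \<plusminus> T h\<close> without increasing norms, and being within 1/2 of the identity
  it shrinks \<open>h\<close> at most by half, whence the factor 2.\<close>

lemma midpoint_rotund_at_transport:
  fixes T :: "'a::real_normed_vector \<Rightarrow>\<^sub>L 'a"
  assumes "midpoint_rotund_at x r \<eta>"
    and T: "norm T \<le> 1" "blinfun_apply T y = x" "norm (T - id_blinfun) < 1/2"
  shows "midpoint_rotund_at y (2 * r) \<eta>"
  unfolding midpoint_rotund_at_def
proof (intro allI impI)
  fix h :: 'a assume h: "2 * r \<le> norm h"
  have "norm (blinfun_apply (T - id_blinfun) h) \<le> 1/2 * norm h"
    using norm_blinfun[of "T - id_blinfun" h] T(3)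
      mult_right_mono[of "norm (T - id_blinfun)" "1/2" "norm h"] by simp
  then have "r \<le> norm (blinfun_apply T h)"
    using norm_triangle_ineq2[of h "h - blinfun_apply T h"] h
    by (simp add: blinfun.diff_left norm_minus_commute)
  then have "1 + \<eta> \<le> max (norm (x + blinfun_apply T h)) (norm (x - blinfun_apply T h))"
    using assms(1) unfolding midpoint_rotund_at_def by blast
  also have "norm (blinfun_apply T z) \<le> norm z" for z
    using norm_blinfun[of T z] mult_right_mono[OF T(1), of "norm z"] by simp
  then have "norm (x + blinfun_apply T h) \<le> norm (y + h)" "norm (x - blinfun_apply T h) \<le> norm (y - h)"
    by (metis T(2) blinfun.add_right, metis T(2) blinfun.diff_right)
  then have "max (norm (x + blinfun_apply T h)) (norm (x - blinfun_apply T h)) \<le> max (norm (y + h)) (norm (y - h))"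
    by (rule max.mono)
  finally show "1 + \<eta> \<le> max (norm (y + h)) (norm (y - h))" .
qed

text \<open>The sign condition forces \<open>norm (x + y) \<ge> 1\<close>, which keeps the segment
  away from 0. For \<open>t \<le> 1/2\<close> the lower bounds \<open>1 - 2 * t\<close> and
  \<open>3 * t - 1\<close> cross at \<open>t = 2/5\<close> with value 1/5; the other half is
  symmetric.\<close>

lemma norm_segment_ge:
  fixes x y :: "'a::real_normed_vector"
  assumes x: "norm x = 1" and y: "norm y = 1" and xy: "norm (x - y) \<le> norm (x + y)" and t: "0 \<le> t" "t \<le> 1"
  shows "1/5 \<le> norm ((1 - t) *\<^sub>R x + t *\<^sub>R y)"
proof -
  have "norm (x + y) + norm (x - y) \<ge> norm (2 *\<^sub>R x)"
    using norm_triangle_ineq[of "x + y" "x - y"] by (simp add: scaleR_2)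
  then have xy1: "norm (x + y) \<ge> 1" using xy x by simp
  have main: "1/5 \<le> norm ((1 - t) *\<^sub>R x + t *\<^sub>R y)"
    if "norm x = 1" "norm y = 1" "norm (x + y) \<ge> 1" "0 \<le> t" "t \<le> 1/2" for x y :: 'a and t
  proof -
    define w where "w = (1 - t) *\<^sub>R x + t *\<^sub>R y"
    have "w = t *\<^sub>R (x + y) + (1 - 2 * t) *\<^sub>R x"
      by (simp add: w_def algebra_simps flip: scaleR_2)
    then have "norm w \<ge> t * norm (x + y) - (1 - 2 * t)"
      using norm_diff_ineq[of "t *\<^sub>R (x + y)" "(1 - 2 * t) *\<^sub>R x"] that by simp
    moreover have "t * norm (x + y) \<ge> t" using that mult_left_mono[of 1 "norm (x + y)" t] by simp
    moreover have "norm w \<ge> (1 - t) - t"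
      using norm_diff_ineq[of "(1 - t) *\<^sub>R x" "t *\<^sub>R y"] that by (simp add: w_def)
    ultimately show ?thesis unfolding w_def[symmetric] by linarith
  qed
  show ?thesis
  proof (cases "t \<le> 1/2")
    case True
    then show ?thesis using main[of x y t] x y xy1 t by simp
  next
    case False
    then show ?thesis using main[of y x "1 - t"] x y xy1 t by (simp add: add.commute)
  qed
qed

text \<open>Equidistant points of the segment, at most \<open>2 / N\<close> apart, are normalised;
  as their norms are at least 1/5, this costs a factor 10. The length \<open>N\<close> depends on
  \<open>\<beta>\<close> alone, which is what makes the convexity uniform.\<close>

lemma sphere_chain:
  fixes x y :: "'a::real_normed_vector"
  assumes "norm x = 1" and "norm y = 1" and "norm (x - y) \<le> norm (x + y)" and N: "20 < \<beta> * real N"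
  obtains p where "p 0 = x" "p N = y" "\<And>i. i \<le> N \<Longrightarrow> norm (p i) = 1"
    "\<And>i. i < N \<Longrightarrow> norm (p (Suc i) - p i) < \<beta>"
proof -
  define q where "q i = (1 - real i / real N) *\<^sub>R x + (real i / real N) *\<^sub>R y" for i
  define p where "p i = sgn (q i)" for i
  have N0: "N > 0" using N by (cases N) auto
  have q: "1/5 \<le> norm (q i)" if "i \<le> N" for i
    unfolding q_def using that N0 by (intro norm_segment_ge assms) auto
  then have unit: "norm (p i) = 1" if "i \<le> N" for i
    using q[OF that] by (auto simp: p_def norm_sgn)
  have "norm (p (Suc i) - p i) < \<beta>" if "i < N" for i
  proof -
    have "q (Suc i) - q i = (1 / real N) *\<^sub>R (y - x)"
      by (simp add: q_def add_divide_distrib algebra_simps)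
    then have "norm (q (Suc i) - q i) \<le> 2 / real N"
      using norm_triangle_ineq4[of y x] assms(1,2) N0 by (simp add: divide_right_mono)
    moreover have q5: "1/5 \<le> norm (q (Suc i))" using q[of "Suc i"] that by simp
    ultimately have "2 * norm (q (Suc i) - q i) / norm (q (Suc i)) \<le> 2 * (2 / real N) / (1/5)"
      by (intro frac_le) auto
    moreover have "q (Suc i) \<noteq> 0" using q5 by auto
    ultimately have "norm (p (Suc i) - p i) \<le> 20 / real N"
      using norm_sgn_diff_le[of "q (Suc i)" "q i"] by (simp add: p_def)
    also have "\<dots> < \<beta>" using N N0 by (simp add: divide_less_eq)
    finally show ?thesis .
  qed
  moreover have "p 0 = x" "p N = y"
    using assms(1,2) N0 by (simp_all add: p_def q_def sgn_div_norm)
  ultimately show ?thesis using that unit by blast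
qed

lemma near_identity_transitive_smooth_imp_uniformly_convex:
  assumes nit: "near_identity_transitive TYPE('a::real_normed_vector)"
    and smooth: "uniformly_smooth TYPE('a)"
  shows "uniformly_convex TYPE('a)"
  unfolding uniformly_convex_def
proof
  fix \<epsilon> :: real assume "\<epsilon> \<in> {0<..2}"
  then have \<epsilon>: "\<epsilon> > 0" by simp
  have "\<exists>c>0. \<forall>u v :: 'a. norm u \<le> 1 \<longrightarrow> norm v \<le> 1 \<longrightarrow> norm (u - v) \<ge> \<epsilon> \<longrightarrow> c \<le> 1 - norm ((u + v) /\<^sub>R 2)"
  proof (cases "\<exists>e::'a. norm e = 1")
    case False
    then have "u = 0" for u :: 'a by (metis norm_sgn)
    then have "norm (u - v) = 0" for u v :: 'a by (metis norm_zero)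
    then show ?thesis using \<epsilon> by (intro exI[of _ 1]) auto
  next
    case True
    then obtain e :: 'a where e: "norm e = 1" by blast
    obtain \<beta> where \<beta>: "\<beta> > 0" "\<And>x y. norm x = 1 \<Longrightarrow> norm (y::'a) = 1 \<Longrightarrow> norm (x - y) < \<beta> \<Longrightarrow>
         \<exists>T :: 'a \<Rightarrow>\<^sub>L 'a. norm T \<le> 1 \<and> blinfun_apply T x = y \<and> norm (T - id_blinfun) < 1/2"
      using near_identity_transitiveD[OF nit, of "1/2"] by auto
    obtain N where N: "20 < \<beta> * real N"
      using reals_Archimedean3[OF \<beta>(1)] by (metis mult.commute)
    \<comment> \<open>The radius is small enough to become \<open>\<epsilon> / 2\<close> after
      \<open>N\<close> doublings.\<close>
    obtain x :: 'a and \<eta> where x: "norm x = 1" "\<eta> > 0" "midpoint_rotund_at x (\<epsilon> / 2 / 2 ^ N) \<eta>"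
      using uniformly_smooth_midpoint_rotund[OF smooth e, of "\<epsilon> / 2 / 2 ^ N"] \<epsilon> by auto
    have near: "midpoint_rotund_at y (\<epsilon> / 2) \<eta>" if y: "norm y = 1" "norm (x - y) \<le> norm (x + y)" for y :: 'a
    proof -
      obtain p where p: "p 0 = x" "p N = y" "\<And>i. i \<le> N \<Longrightarrow> norm (p i) = 1"
        "\<And>i. i < N \<Longrightarrow> norm (p (Suc i) - p i) < \<beta>"
        using sphere_chain[OF x(1) y N] by blast
      have "midpoint_rotund_at (p i) (2 ^ i * (\<epsilon> / 2 / 2 ^ N)) \<eta>" if "i \<le> N" for i
        using that
      proof (induction i)
        case 0
        then show ?case using x p by simp
      next
        case (Suc i)
        \<comment> \<open>The operator runs backwards along the chain, since rotundity is pulled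
          back from the image point.\<close>
        obtain T :: "'a \<Rightarrow>\<^sub>L 'a" where "norm T \<le> 1" "blinfun_apply T (p (Suc i)) = p i" "norm (T - id_blinfun) < 1/2"
          using \<beta>(2)[of "p (Suc i)" "p i"] p(3)[of i] p(3)[of "Suc i"] p(4)[of i] Suc.prems by auto
        then have "midpoint_rotund_at (p (Suc i)) (2 * (2 ^ i * (\<epsilon> / 2 / 2 ^ N))) \<eta>"
          using midpoint_rotund_at_transport Suc by (metis Suc_leD)
        then show ?case by (simp add: mult.assoc)
      qed
      from this[of N] show ?thesis by (simp add: p)
    qed
    have rotund: "midpoint_rotund_at y (\<epsilon> / 2) \<eta>" if y: "norm y = 1" for y :: 'a
    proof (cases "norm (x - y) \<le> norm (x + y)")
      case True
      then show ?thesis by (rule near[OF y])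
    next
      case False
      then have "midpoint_rotund_at (- y) (\<epsilon> / 2) \<eta>" using near[of "- y"] y by simp
      then show ?thesis using midpoint_rotund_at_minus by fastforce
    qed
    \<comment> \<open>With \<open>u = m + h\<close> and \<open>v = m - h\<close>, moving
      \<open>m\<close> to the sphere costs less than \<open>c\<close>, so
      \<open>c \<le> \<eta>\<close> contradicts rotundity at \<open>sgn m\<close>; the bound 1/2
      ensures \<open>m \<noteq> 0\<close>.\<close>
    define c where "c = min (1/2) \<eta>"
    have c: "c > 0" "c \<le> 1/2" "c \<le> \<eta>" using x(2) by (auto simp: c_def)
    have "c \<le> 1 - norm ((u + v) /\<^sub>R 2)" if uv: "norm u \<le> 1" "norm v \<le> 1" "norm (u - v) \<ge> \<epsilon>" for u v :: 'a
    proof (rule ccontr)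
      define m where "m = (u + v) /\<^sub>R 2"
      define h where "h = (u - v) /\<^sub>R 2"
      assume "\<not> c \<le> 1 - norm ((u + v) /\<^sub>R 2)"
      then have m: "norm m > 1 - c" by (simp add: m_def)
      have mh: "m + h = u" "m - h = v"
        by (simp_all add: m_def h_def algebra_simps flip: scaleR_2 scaleR_add_left)
      have m1: "norm m \<le> 1" using norm_triangle_ineq[of u v] uv by (simp add: m_def)
      have m0: "m \<noteq> 0" using m c by auto
      have "norm m *\<^sub>R sgn m = m" using m0 by (simp add: sgn_div_norm)
      then have "sgn m - m = (1 - norm m) *\<^sub>R sgn m" by (simp add: scaleR_diff_left)
      then have d: "norm (sgn m - m) < c" using m m1 m0 by (simp add: norm_sgn)
      have eq: "sgn m + h = u + (sgn m - m)" "sgn m - h = v + (sgn m - m)"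
        by (simp_all flip: mh)
      have "norm (sgn m + h) < 1 + c" "norm (sgn m - h) < 1 + c"
        unfolding eq using norm_triangle_ineq[of u "sgn m - m"] norm_triangle_ineq[of v "sgn m - m"] d uv
        by linarith+
      moreover have "\<epsilon> / 2 \<le> norm h" using uv(3) by (simp add: h_def)
      then have "1 + \<eta> \<le> max (norm (sgn m + h)) (norm (sgn m - h))"
        using rotund[of "sgn m"] m0 unfolding midpoint_rotund_at_def by (simp add: norm_sgn)
      ultimately show False using c by auto
    qed
    then show ?thesis using c(1) by blast
  qed
  then obtain c where c: "c > 0" "\<And>u v :: 'a. norm u \<le> 1 \<Longrightarrow> norm v \<le> 1 \<Longrightarrow> norm (u - v) \<ge> \<epsilon> \<Longrightarrow>
      c \<le> 1 - norm ((u + v) /\<^sub>R 2)"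
    by blast
  have "ereal c \<le> modulus_of_convexity TYPE('a) \<epsilon>"
    unfolding modulus_of_convexity_def using c(2) by (intro Inf_greatest) auto
  moreover have "0 < ereal c" using c(1) by simp
  ultimately show "0 < modulus_of_convexity TYPE('a) \<epsilon>" by (rule less_le_trans[rotated])
qed

subsection \<open>Micro-transitivity\<close>

context banach_space_over
begin

lemma isometry_group_norm: "T \<in> isometry_group smul \<Longrightarrow> norm (blinfun_apply T x) = norm x"
  by (simp add: isometry_group_def)

lemma isometry_group_id: "id_blinfun \<in> isometry_group smul"
  by (auto simp: isometry_group_def bounded_operators_def surj_def)

lemma isometry_group_uminus_id: "- id_blinfun \<in> isometry_group smul"
  by (auto simp: isometry_group_def bounded_operators_def blinfun.minus_left surj_def scale_minus_right
      intro: exI[of _ "- _"])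

lemma isometry_group_compose:
  assumes "S \<in> isometry_group smul" "T \<in> isometry_group smul"
  shows "S o\<^sub>L T \<in> isometry_group smul"
proof -
  have "surj (\<lambda>x. blinfun_apply S (blinfun_apply T x))"
    using assms comp_surj[of "blinfun_apply T" "blinfun_apply S"] by (simp add: isometry_group_def comp_def)
  then show ?thesis
    using assms by (simp add: isometry_group_def bounded_operators_def blinfun_apply_blinfun_compose)
qed

lemma isometry_group_inverse:
  assumes T: "T \<in> isometry_group smul"
  obtains S where "S \<in> isometry_group smul" "\<And>x. blinfun_apply S (blinfun_apply T x) = x"
    "\<And>x. blinfun_apply T (blinfun_apply S x) = x"
proof -
  have surj: "surj (blinfun_apply T)" and lin: "\<And>c x. blinfun_apply T (smul c x) = smul c (blinfun_apply T x)"
    using T by (auto simp: isometry_group_def bounded_operators_def)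
  have inj: "inj (blinfun_apply T)"
  proof (rule injI)
    fix x y assume "blinfun_apply T x = blinfun_apply T y"
    then have "norm (blinfun_apply T (x - y)) = 0" by (simp add: blinfun.diff_right)
    then show "x = y" by (simp add: isometry_group_norm[OF T])
  qed
  define R where "R = inv (blinfun_apply T)"
  have TR: "blinfun_apply T (R x) = x" for x unfolding R_def by (rule surj_f_inv_f[OF surj])
  have RT: "R (blinfun_apply T x) = x" for x unfolding R_def by (rule inv_f_f[OF inj])
  have normR: "norm (R x) = norm x" for x using isometry_group_norm[OF T, of "R x"] by (simp add: TR)
  have "bounded_linear R"
  proof (rule bounded_linear_intro[where K = 1])
    show "R (x + y) = R x + R y" for x y
      by (rule injD[OF inj]) (simp add: TR blinfun.add_right)
    show "R (r *\<^sub>R x) = r *\<^sub>R R x" for r x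
      by (rule injD[OF inj]) (simp add: TR blinfun.scaleR_right)
  qed (simp add: normR)
  then have app: "blinfun_apply (Blinfun R) = R" by (rule bounded_linear_Blinfun_apply)
  have "R (smul c x) = smul c (R x)" for c x
    by (rule injD[OF inj]) (simp add: TR lin)
  moreover have "surj R" by (metis RT surjI)
  ultimately have "Blinfun R \<in> isometry_group smul"
    by (simp add: isometry_group_def bounded_operators_def app normR)
  then show ?thesis using that by (simp add: app TR RT)
qed

text \<open>The metric form of the definition. The radius still depends on \<open>x\<close>;
  transitivity will make it uniform.\<close>

lemma micro_transitive_local:
  assumes "micro_transitive smul" and x: "norm x = 1" and \<epsilon>: "\<epsilon> > 0"
  obtains r where "r > 0" "\<And>y. norm y = 1 \<Longrightarrow> norm (x - y) < r \<Longrightarrow>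
    \<exists>T \<in> isometry_group smul. blinfun_apply T x = y \<and> norm (T - id_blinfun) < \<epsilon>"
proof -
  let ?G = "isometry_group smul"
  define U where "U = ?G \<inter> ball id_blinfun \<epsilon>"
  have "openin (top_of_set ?G) U" unfolding U_def by (simp add: openin_open_Int)
  then have "neighbourhood_in (top_of_set ?G) id_blinfun U"
    unfolding neighbourhood_in_def using \<epsilon> isometry_group_id by (auto simp: U_def)
  then have "neighbourhood_in (top_of_set (sphere 0 1)) x ((\<lambda>T. blinfun_apply T x) ` U)"
    using assms(1) x unfolding micro_transitive_def by simp
  then obtain V where V: "openin (top_of_set (sphere 0 1)) V" "x \<in> V" "V \<subseteq> (\<lambda>T. blinfun_apply T x) ` U"
    unfolding neighbourhood_in_def by blast
  then obtain r where r: "r > 0" "ball x r \<inter> sphere 0 1 \<subseteq> V"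
    unfolding openin_contains_ball by blast
  have "\<exists>T \<in> ?G. blinfun_apply T x = y \<and> norm (T - id_blinfun) < \<epsilon>"
    if "norm y = 1" "norm (x - y) < r" for y
  proof -
    have "y \<in> (\<lambda>T. blinfun_apply T x) ` U" using that r V(3) by (auto simp: dist_norm)
    then show ?thesis by (auto simp: U_def dist_norm norm_minus_commute)
  qed
  with r(1) that show ?thesis by blast
qed

text \<open>The orbits are open, hence a connected path in the sphere lies in a single one; if the
  segment from \<open>x\<close> to \<open>y\<close> comes close to \<open>0\<close>, then the one from \<open>x\<close> to \<open>- y\<close> does not.\<close>

lemma micro_transitive_imp_transitive:
  assumes mt: "micro_transitive smul" and x: "norm x = 1" and y: "norm y = 1"
  shows "\<exists>T \<in> isometry_group smul. blinfun_apply T x = y"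
proof -
  let ?G = "isometry_group smul"
  have near: "\<exists>T \<in> ?G. blinfun_apply T x = y" if y: "norm y = 1" and xy: "norm (x - y) \<le> norm (x + y)" for y
  proof -
    define \<gamma> where "\<gamma> t = sgn ((1 - t) *\<^sub>R x + t *\<^sub>R y)" for t :: real
    have nz: "(1 - t) *\<^sub>R x + t *\<^sub>R y \<noteq> 0" if "t \<in> {0..1}" for t
      using norm_segment_ge[OF x y xy, of t] that by auto
    have "continuous_on {0..1} \<gamma>"
      unfolding \<gamma>_def using nz by (intro continuous_intros) auto
    then have conn: "connected (\<gamma> ` {0..1})" by (rule connected_continuous_image) simp
    have unit: "norm z = 1" if "z \<in> \<gamma> ` {0..1}" for z
      using that nz by (auto simp: \<gamma>_def norm_sgn)
    have ends: "\<gamma> 0 = x" "\<gamma> 1 = y" using x y by (simp_all add: \<gamma>_def sgn_div_norm)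
    show ?thesis
    proof (rule connected_equivalence_relation[OF conn, where R = "\<lambda>x y. \<exists>T \<in> ?G. blinfun_apply T x = y"])
      show "\<exists>T \<in> ?G. blinfun_apply T b = a" if "\<exists>T \<in> ?G. blinfun_apply T a = b" for a b
        using that by (metis isometry_group_inverse)
      show "\<exists>T \<in> ?G. blinfun_apply T a = c"
        if "\<exists>T \<in> ?G. blinfun_apply T a = b" "\<exists>T \<in> ?G. blinfun_apply T b = c" for a b c
        using that by (metis isometry_group_compose blinfun_apply_blinfun_compose)
      show "\<exists>V. openin (top_of_set (\<gamma> ` {0..1})) V \<and> a \<in> V \<and> (\<forall>z \<in> V. \<exists>T \<in> ?G. blinfun_apply T a = z)"
        if a: "a \<in> \<gamma> ` {0..1}" for a
      proof -
        obtain r where r: "r > 0" "\<And>y. norm y = 1 \<Longrightarrow> norm (a - y) < r \<Longrightarrow>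
            \<exists>T \<in> ?G. blinfun_apply T a = y \<and> norm (T - id_blinfun) < 1"
          using micro_transitive_local[OF mt unit[OF a], of 1] by auto
        have "openin (top_of_set (\<gamma> ` {0..1})) (\<gamma> ` {0..1} \<inter> ball a r)" by (simp add: openin_open_Int)
        moreover have "a \<in> \<gamma> ` {0..1} \<inter> ball a r" using a r(1) by simp
        moreover have "\<exists>T \<in> ?G. blinfun_apply T a = z" if "z \<in> \<gamma> ` {0..1} \<inter> ball a r" for z
          using r(2)[of z] unit[of z] that by (auto simp: dist_norm)
        ultimately show ?thesis by meson
      qed
      show "x \<in> \<gamma> ` {0..1}" "y \<in> \<gamma> ` {0..1}"
        using ends by (auto intro!: image_eqI[of x \<gamma> 0] image_eqI[of y \<gamma> 1])
    qed
  qed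
  show ?thesis
  proof (cases "norm (x - y) \<le> norm (x + y)")
    case True
    then show ?thesis by (rule near[OF y])
  next
    case False
    then obtain T where "T \<in> ?G" "blinfun_apply T x = - y" using near[of "- y"] y by auto
    then show ?thesis
      using isometry_group_compose[OF isometry_group_uminus_id, of T]
      by (intro bexI[of _ "(- id_blinfun) o\<^sub>L T"]) (auto simp: blinfun.minus_left)
  qed
qed

text \<open>By transitivity the radius at one point works at every other one, by conjugation.\<close>

lemma micro_transitive_imp_near_identity_transitive:
  assumes mt: "micro_transitive smul"
  shows "near_identity_transitive TYPE('a)"
  unfolding near_identity_transitive_def
proof (intro allI impI)
  fix \<epsilon> :: real assume \<epsilon>: "\<epsilon> > 0"
  let ?G = "isometry_group smul"
  show "\<exists>\<beta>>0. \<forall>x \<in> sphere (0::'a) 1. \<forall>y \<in> sphere 0 1. norm (x - y) < \<beta> \<longrightarrow>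
        (\<exists>T :: 'a \<Rightarrow>\<^sub>L 'a. norm T \<le> 1 \<and> blinfun_apply T x = y \<and> norm (T - id_blinfun) < \<epsilon>)"
  proof (cases "\<exists>e::'a. norm e = 1")
    case False
    then show ?thesis by (intro exI[of _ 1]) simp
  next
    case True
    then obtain e :: 'a where e: "norm e = 1" by blast
    obtain r where r: "r > 0" "\<And>y. norm y = 1 \<Longrightarrow> norm (e - y) < r \<Longrightarrow>
        \<exists>T \<in> ?G. blinfun_apply T e = y \<and> norm (T - id_blinfun) < \<epsilon>"
      using micro_transitive_local[OF mt e \<epsilon>] by blast
    have "\<exists>T :: 'a \<Rightarrow>\<^sub>L 'a. norm T \<le> 1 \<and> blinfun_apply T x = y \<and> norm (T - id_blinfun) < \<epsilon>"
      if x: "norm x = 1" and y: "norm y = 1" and xy: "norm (x - y) < r" for x y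
    proof -
      obtain S where S: "S \<in> ?G" "blinfun_apply S e = x"
        using micro_transitive_imp_transitive[OF mt e x] by blast
      obtain S' where S': "S' \<in> ?G" "\<And>x. blinfun_apply S' (blinfun_apply S x) = x"
        "\<And>x. blinfun_apply S (blinfun_apply S' x) = x"
        using isometry_group_inverse[OF S(1)] by blast
      have "e - blinfun_apply S' y = blinfun_apply S' (x - y)"
        using S'(2)[of e] S(2) by (simp add: blinfun.diff_right)
      then have "norm (e - blinfun_apply S' y) < r" using xy by (simp add: isometry_group_norm[OF S'(1)])
      moreover have "norm (blinfun_apply S' y) = 1" using y by (simp add: isometry_group_norm[OF S'(1)])
      ultimately obtain T where T: "T \<in> ?G" "blinfun_apply T e = blinfun_apply S' y" "norm (T - id_blinfun) < \<epsilon>"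
        using r(2) by blast
      \<comment> \<open>\<open>Q - Id\<close> is \<open>S (T - Id) S'\<close>, so conjugation by the
        isometry \<open>S\<close> does not increase the distance to the identity.\<close>
      define Q where "Q = S o\<^sub>L T o\<^sub>L S'"
      have "norm Q \<le> 1"
        by (rule norm_blinfun_bound)
          (simp_all add: Q_def isometry_group_norm[OF S(1)] isometry_group_norm[OF T(1)] isometry_group_norm[OF S'(1)])
      moreover have "blinfun_apply Q x = y"
        using S'(2)[of e] by (simp add: Q_def S(2) T(2) S'(3))
      moreover have "norm (Q - id_blinfun) \<le> norm (T - id_blinfun)"
      proof (rule norm_blinfun_bound)
        fix z
        have "blinfun_apply (Q - id_blinfun) z = blinfun_apply S (blinfun_apply (T - id_blinfun) (blinfun_apply S' z))"
          by (simp add: Q_def blinfun.diff_left blinfun.diff_right S'(3))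
        then have "norm (blinfun_apply (Q - id_blinfun) z) = norm (blinfun_apply (T - id_blinfun) (blinfun_apply S' z))"
          by (simp add: isometry_group_norm[OF S(1)])
        also have "\<dots> \<le> norm (T - id_blinfun) * norm z"
          using norm_blinfun[of "T - id_blinfun" "blinfun_apply S' z"] by (simp add: isometry_group_norm[OF S'(1)])
        finally show "norm (blinfun_apply (Q - id_blinfun) z) \<le> norm (T - id_blinfun) * norm z" .
      qed simp
      ultimately show ?thesis using T(3) by (intro exI[of _ Q]) auto
    qed
    then show ?thesis using r(1) by (intro exI[of _ r]) auto
  qed
qed

end

section \<open>Semitransitive norms and the conclusion\<close>

lemma uniformly_micro_semitransitive_imp_near_identity_transitive:
  fixes smul :: "'k::real_normed_field \<Rightarrow> 'a::banach \<Rightarrow> 'a"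
  assumes "uniformly_micro_semitransitive smul"
  shows "near_identity_transitive TYPE('a)"
  unfolding near_identity_transitive_def
proof (intro allI impI)
  fix \<epsilon> :: real assume "\<epsilon> > 0"
  \<comment> \<open>Only the values of \<open>\<beta>\<close> on (0, 2) are controlled, so a large
    \<open>\<epsilon>\<close> is cut down to 1.\<close>
  then have \<epsilon>: "min \<epsilon> 1 \<in> {0<..<2}" by auto
  obtain \<beta> where \<beta>: "\<forall>\<epsilon> \<in> {0<..<2}. \<beta> \<epsilon> > 0" "\<forall>\<epsilon> \<in> {0<..<2}. \<forall>x \<in> sphere 0 1. \<forall>y \<in> sphere 0 1.
      norm (x - y) < \<beta> \<epsilon> \<longrightarrow>
      (\<exists>T \<in> bounded_operators smul. norm T = 1 \<and> blinfun_apply T x = y \<and> norm (T - id_blinfun) < \<epsilon>)"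
    using assms unfolding uniformly_micro_semitransitive_def by (elim exE conjE)
  have "\<exists>T :: 'a \<Rightarrow>\<^sub>L 'a. norm T \<le> 1 \<and> blinfun_apply T x = y \<and> norm (T - id_blinfun) < \<epsilon>"
    if "x \<in> sphere 0 1" "y \<in> sphere 0 1" "norm (x - y) < \<beta> (min \<epsilon> 1)" for x y
    using \<beta>(2)[rule_format, OF \<epsilon> that] by (metis min_less_iff_conj order_refl)
  then show "\<exists>\<beta>>0. \<forall>x \<in> sphere (0::'a) 1. \<forall>y \<in> sphere 0 1. norm (x - y) < \<beta> \<longrightarrow>
        (\<exists>T :: 'a \<Rightarrow>\<^sub>L 'a. norm T \<le> 1 \<and> blinfun_apply T x = y \<and> norm (T - id_blinfun) < \<epsilon>)"
    using \<beta>(1) \<epsilon> by (intro exI[of _ "\<beta> (min \<epsilon> 1)"]) blast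
qed

lemma near_identity_transitive_imp_smooth_convex:
  assumes "near_identity_transitive TYPE('a::real_normed_vector)"
  shows "uniformly_smooth TYPE('a) \<and> uniformly_convex TYPE('a)"
proof -
  have "uniformly_smooth TYPE('a)"
    by (rule uniformly_smoothI) (rule near_identity_transitive_imp_second_difference[OF assms])
  with near_identity_transitive_smooth_imp_uniformly_convex[OF assms] show ?thesis by simp
qed

theorem corollary2p13:
  fixes smulC :: "complex \<Rightarrow> 'b::banach \<Rightarrow> 'b"
  shows
    "((uniformly_micro_semitransitive ((*\<^sub>R) :: real \<Rightarrow> 'a::banach \<Rightarrow> 'a) \<longrightarrow>
         uniformly_smooth TYPE('a) \<and> uniformly_convex TYPE('a)) \<and>
      (micro_transitive ((*\<^sub>R) :: real \<Rightarrow> 'a \<Rightarrow> 'a) \<longrightarrow>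
         uniformly_smooth TYPE('a) \<and> uniformly_convex TYPE('a))) \<and>
     (banach_space_over smulC \<longrightarrow>
        (uniformly_micro_semitransitive smulC \<longrightarrow>
           uniformly_smooth TYPE('b) \<and> uniformly_convex TYPE('b)) \<and>
        (micro_transitive smulC \<longrightarrow>
           uniformly_smooth TYPE('b) \<and> uniformly_convex TYPE('b)))"
  using near_identity_transitive_imp_smooth_convex[where 'a = 'a]
    near_identity_transitive_imp_smooth_convex[where 'a = 'b]
    uniformly_micro_semitransitive_imp_near_identity_transitive[of "(*\<^sub>R) :: real \<Rightarrow> 'a \<Rightarrow> 'a"]
    uniformly_micro_semitransitive_imp_near_identity_transitive[of smulC]
    banach_space_over.micro_transitive_imp_near_identity_transitive[OF banach_space_over_scaleR[where 'a = 'a]]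
    banach_space_over.micro_transitive_imp_near_identity_transitive[of smulC]
  by blast

end
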